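(* Let $(\bar X_n)_{n\ge1}$ be nonnegative random variables such that $R^*:=\lim_{n\to\infty}\mathbb{E}[\bar X_n]$ exists with $0<R^*<\infty$, such that $(\bar X_n)_{n\ge1}$ satisfies a large deviations principle (speed $n$) with good convex rate function $I$, and such that $\limsup_{n\to\infty}\mathbb{E}[(\bar X_n)^{\gamma n}]^{1/n}<\infty$ for some $\gamma>1$. Let $$\tau_v=-\tfrac12\log(2\pi e)+\inf_{R\ge R^*}\bigl(I(R)-\log R\bigr),$$ $$\tau_p=-\tfrac12\log(2\pi e)+\inf_{R\ge R^*}\bigl(I(R)-\log(R+R^* )\bigr),$$ $$\tau_d=-\tfrac12\log(2\pi e)+\inf_{R\ge R^*}\bigl(2I(R)-\log(2R)\bigr)$$ be, respectively, the volume fraction, percolation and degree thresholds. Then $$\tau_d\le\tau_p\le\tau_v.$$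
   Context: $\log$ is the natural logarithm. A good rate function is a lower semicontinuous function $I:\mathbb{R}\to[0,\infty]$ with compact sublevel sets. Under the assumptions, $I(R^* )=0$. The names of $\tau_v,\tau_p,\tau_d$ refer to the Boolean models in $\mathbb{R}^n$ with Poisson centers of intensity $e^{n\rho_n}$, $\rho_n\to\rho$, and i.i.d. ball radii distributed as $\bar X_n\sqrt n$; for the purposes of this statement the three thresholds are the numbers given by the displayed formulas. *)

theory Defs
  imports "HOL-Probability.Probability"
begin

definition extended_ln :: "real \<Rightarrow> ereal" where
  "extended_ln p = (if p \<le> 0 then -\<infinity> else ereal (ln p))"

(* Meant for p > 0 only. *)
definition ennreal_powr :: "ennreal \<Rightarrow> real \<Rightarrow> ennreal" where
  "ennreal_powr x p = (if x = \<infinity> then \<infinity> else ennreal (enn2real x powr p))"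

definition good_rate_function :: "(real \<Rightarrow> ereal) \<Rightarrow> bool" where
  "good_rate_function I \<longleftrightarrow>
     (\<forall>x. 0 \<le> I x) \<and>
     (\<forall>x. I x \<le> Liminf (at x) I) \<and>
     (\<forall>a::real. compact {x. I x \<le> ereal a})"

(* For values in [0,\<infinity>] the ereal convention 0 * \<infinity> = 0 makes u = 0 and u = 1 harmless. *)
definition convex_ereal :: "(real \<Rightarrow> ereal) \<Rightarrow> bool" where
  "convex_ereal I \<longleftrightarrow>
     (\<forall>x y u. 0 \<le> u \<and> u \<le> 1 \<longrightarrow>
        I (u * x + (1 - u) * y) \<le> ereal u * I x + ereal (1 - u) * I y)"

(* Large deviations principle with speed n; the value of the sequence at n = 0 is irrelevant. *)
definition large_deviations_principle ::
    "(nat \<Rightarrow> 'a measure) \<Rightarrow> (nat \<Rightarrow> 'a \<Rightarrow> real) \<Rightarrow> (real \<Rightarrow> ereal) \<Rightarrow> bool" where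
  "large_deviations_principle M X I \<longleftrightarrow>
     (\<forall>F. closed F \<longrightarrow>
        limsup (\<lambda>n. ereal (1 / real n) *
          extended_ln (measure (M n) {\<omega> \<in> space (M n). X n \<omega> \<in> F}))
        \<le> - (INF x\<in>F. I x)) \<and>
     (\<forall>G. open G \<longrightarrow>
        - (INF x\<in>G. I x)
        \<le> liminf (\<lambda>n. ereal (1 / real n) *
          extended_ln (measure (M n) {\<omega> \<in> space (M n). X n \<omega> \<in> G})))"

definition volume_fraction_threshold :: "(real \<Rightarrow> ereal) \<Rightarrow> real \<Rightarrow> ereal" where
  "volume_fraction_threshold I Rs =
     ereal (- (1/2) * ln (2 * pi * exp 1)) + (INF R\<in>{Rs..}. I R - ereal (ln R))"

definition percolation_threshold :: "(real \<Rightarrow> ereal) \<Rightarrow> real \<Rightarrow> ereal" where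
  "percolation_threshold I Rs =
     ereal (- (1/2) * ln (2 * pi * exp 1)) + (INF R\<in>{Rs..}. I R - ereal (ln (R + Rs)))"

definition degree_threshold :: "(real \<Rightarrow> ereal) \<Rightarrow> real \<Rightarrow> ereal" where
  "degree_threshold I Rs =
     ereal (- (1/2) * ln (2 * pi * exp 1)) + (INF R\<in>{Rs..}. 2 * I R - ereal (ln (2 * R)))"

end

theory Submission
  imports Defs
begin

text \<open>
  Everything rests on \<open>I Rs = 0\<close>. The zero set of \<open>I\<close> is a nonempty compact interval, and the upper
  bound of the large deviations principle makes the law of \<open>X n\<close> concentrate on it. If \<open>Rs\<close> lay to
  its left, the mean would stay above some \<open>c > Rs\<close>; if \<open>Rs\<close> lay to its right, the moment bound would
  rule out a contribution of the tail to the mean, which would stay below some \<open>c < Rs\<close>.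
  Given \<open>I Rs = 0\<close>, convexity yields \<open>2 * I ((R + Rs) / 2) \<le> I R\<close>, so the midpoint of \<open>R\<close> and \<open>Rs\<close>
  is a competitor in the infimum for the degree threshold.
\<close>

section \<open>Exponential decay and the zeros of the rate function\<close>

text \<open>Goodness supplies the compactness: the parts of \<open>F\<close> where \<open>I\<close>
  is at most \<open>1 / (k + 1)\<close> are compact, nonempty and decreasing in \<open>k\<close>, so
  they share a point. Used in contrapositive form: without a zero of \<open>I\<close> on
  \<open>F\<close>, the infimum over \<open>F\<close> is strictly positive.\<close>

lemma good_rate_function_zero_in_closed:
  assumes "good_rate_function I" "closed F" "(INF x\<in>F. I x) \<le> 0"
  obtains x where "x \<in> F" "I x = 0"
proof -
  define S where "S k = F \<inter> {x. I x \<le> ereal (1 / real (Suc k))}" for k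
  have "compact (S k)" for k
    using assms(1,2) unfolding S_def good_rate_function_def by (simp add: closed_Int_compact)
  moreover have "S k \<noteq> {}" for k
  proof -
    have "(INF x\<in>F. I x) < ereal (1 / real (Suc k))"
      using assms(3) by (rule le_less_trans) simp
    then obtain x where "x \<in> F" "I x < ereal (1 / real (Suc k))"
      by (auto simp: INF_less_iff)
    then show ?thesis
      unfolding S_def by auto
  qed
  moreover have "S n \<subseteq> S m" if "m \<le> n" for m n
  proof -
    have "ereal (1 / real (Suc n)) \<le> ereal (1 / real (Suc m))"
      using that by (simp add: field_simps)
    then show ?thesis
      unfolding S_def by (auto intro: order_trans)
  qed
  ultimately have "(\<Inter>k. S k) \<noteq> {}"
    by (rule compact_nest)
  then obtain x where x: "\<And>k. x \<in> S k"
    by blast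
  have "(\<lambda>k. ereal (1 / real (Suc k))) \<longlonglongrightarrow> ereal 0"
    by (intro tendsto_intros LIMSEQ_Suc lim_1_over_n)
  then have "I x \<le> ereal 0"
    by (rule LIMSEQ_le_const) (use x in \<open>auto simp: S_def\<close>)
  moreover have "0 \<le> I x"
    using assms(1) unfolding good_rate_function_def by blast
  ultimately have "I x = 0"
    by (simp add: zero_ereal_def)
  with x show thesis
    using that unfolding S_def by blast
qed

text \<open>A real \<open>y\<close> strictly between the limsup and 0 gives the eventual geometric
  bound \<open>exp y ^ n\<close> with ratio below 1.\<close>

lemma tendsto_zero_of_exponential_rate:
  fixes p :: "nat \<Rightarrow> real"
  assumes "\<And>n. 0 \<le> p n"
    and "limsup (\<lambda>n. ereal (1 / real n) * extended_ln (p n)) < 0"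
  shows "p \<longlonglongrightarrow> 0"
proof -
  obtain y where y: "limsup (\<lambda>n. ereal (1 / real n) * extended_ln (p n)) < ereal y" "ereal y < 0"
    using ereal_dense2[OF assms(2)] by blast
  then have "y < 0"
    by (simp add: zero_ereal_def)
  have "eventually (\<lambda>n. ereal (1 / real n) * extended_ln (p n) < ereal y) sequentially"
    using y(1) by (rule Limsup_lessD)
  \<comment> \<open>Clearing the factor \<open>1 / real n\<close> requires \<open>n\<close> to be
    positive, since Isabelle's value at \<open>n = 0\<close> is 0.\<close>
  then have "eventually (\<lambda>n. p n \<le> exp y ^ n) sequentially"
    using eventually_gt_at_top[of 0]
  proof eventually_elim
    case (elim n)
    show ?case
    proof (cases "p n \<le> 0")
      case False
      then have "ln (p n) < y * real n"
        using elim by (simp add: extended_ln_def field_simps)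
      then have "p n \<le> exp (y * real n)"
        using False by (metis exp_le_cancel_iff exp_ln less_imp_le not_le)
      then show ?thesis
        by (simp add: exp_of_nat2_mult)
    qed (simp add: order_trans[of _ 0])
  qed
  moreover have "(\<lambda>n. exp y ^ n) \<longlonglongrightarrow> 0"
    using \<open>y < 0\<close> by (intro LIMSEQ_realpow_zero) auto
  ultimately show ?thesis
    using assms(1) by (intro tendsto_sandwich[of "\<lambda>_. 0" p sequentially "\<lambda>n. exp y ^ n"]) auto
qed

text \<open>This is the concentration statement: a closed set without zeros of \<open>I\<close> has
  positive infimum, so the upper bound of the large deviations principle makes its probability decay
  exponentially.\<close>

lemma ldp_measure_tendsto_zero:
  assumes "good_rate_function I" "large_deviations_principle M X I"
    and "closed F" "\<And>x. x \<in> F \<Longrightarrow> I x \<noteq> 0"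
  shows "(\<lambda>n. measure (M n) {\<omega> \<in> space (M n). X n \<omega> \<in> F}) \<longlonglongrightarrow> 0"
proof (rule tendsto_zero_of_exponential_rate)
  have "0 < (INF x\<in>F. I x)"
    using good_rate_function_zero_in_closed[OF assms(1,3)] assms(4) by (metis not_le)
  then have "- (INF x\<in>F. I x) < 0"
    by (simp add: ereal_uminus_less_reorder)
  then show "limsup (\<lambda>n. ereal (1 / real n) *
      extended_ln (measure (M n) {\<omega> \<in> space (M n). X n \<omega> \<in> F})) < 0"
    using assms(2,3) unfolding large_deviations_principle_def by (blast intro: le_less_trans)
qed simp

text \<open>If \<open>I\<close> had no zero, concentration applied to the whole line would send the
  total mass to 0, although it is 1 for every \<open>n\<close> from 1 on.\<close>

lemma ldp_zero_exists:
  assumes "\<And>n. n \<ge> 1 \<Longrightarrow> prob_space (M n)"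
    and "good_rate_function I" "large_deviations_principle M X I"
  obtains z where "I z = 0"
proof (rule ccontr)
  assume "\<not> thesis"
  then have "\<And>x. I x \<noteq> 0"
    using that by blast
  then have "(\<lambda>n. measure (M n) (space (M n))) \<longlonglongrightarrow> 0"
    using ldp_measure_tendsto_zero[OF assms(2,3), of UNIV] by simp
  moreover have "(\<lambda>n. measure (M n) (space (M n))) \<longlonglongrightarrow> 1"
    by (rule tendsto_eventually)
      (use assms(1) in \<open>auto simp: eventually_sequentially intro!: exI[of _ 1] prob_space.prob_space\<close>)
  ultimately show False
    using LIMSEQ_unique by fastforce
qed

lemma convex_ereal_zero_between:
  assumes "convex_ereal I" "\<And>x. 0 \<le> I x" "I a = 0" "I b = 0" "a \<le> x" "x \<le> b"
  shows "I x = 0"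
proof (cases "a = b")
  case False
  \<comment> \<open>The barycentric weight that makes \<open>x\<close> equal to
    \<open>u * a + (1 - u) * b\<close>.\<close>
  define u where "u = (b - x) / (b - a)"
  have "0 \<le> u" "u \<le> 1"
    using assms(5,6) False by (auto simp: u_def field_simps)
  moreover have "u * (b - a) = b - x"
    using False by (simp add: u_def)
  then have "u * a + (1 - u) * b = x"
    by (simp add: algebra_simps)
  ultimately have "I x \<le> ereal u * I a + ereal (1 - u) * I b"
    using assms(1) unfolding convex_ereal_def by metis
  then show ?thesis
    using assms(2)[of x] assms(3,4) by simp
qed (use assms in auto)

section \<open>Moment growth and bounds on the limit of the means\<close>

lemma eventually_le_power_of_limsup_root:
  assumes "limsup (\<lambda>n. ennreal_powr (m n) (1 / real n)) < \<infinity>"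
  obtains C :: real where "0 < C" "eventually (\<lambda>n. m n \<le> ennreal (C ^ n)) sequentially"
proof -
  obtain C where C: "limsup (\<lambda>n. ennreal_powr (m n) (1 / real n)) = ennreal C" "0 \<le> C"
    using assms by (cases "limsup (\<lambda>n. ennreal_powr (m n) (1 / real n))") auto
  \<comment> \<open>Adding 1 makes the bound strict and keeps the base positive even when the limsup
    is 0.\<close>
  have "limsup (\<lambda>n. ennreal_powr (m n) (1 / real n)) < ennreal (C + 1)"
    using C by (simp add: ennreal_less_iff)
  then have "eventually (\<lambda>n. ennreal_powr (m n) (1 / real n) < ennreal (C + 1)) sequentially"
    by (rule Limsup_lessD)
  then have "eventually (\<lambda>n. m n \<le> ennreal ((C + 1) ^ n)) sequentially"
    using eventually_gt_at_top[of 0]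
  proof eventually_elim
    case (elim n)
    show ?case
    proof (cases "m n")
      case (real r)
      then have "r powr (1 / real n) \<le> C + 1"
        using elim(1) by (simp add: ennreal_powr_def ennreal_less_iff)
      then have "(r powr (1 / real n)) ^ n \<le> (C + 1) ^ n"
        by (intro power_mono) auto
      moreover have "(r powr (1 / real n)) ^ n = r"
        using elim(2) real(1) by (cases "r = 0") (auto simp: powr_powr powr_realpow[symmetric])
      ultimately show ?thesis
        using real by (simp add: ennreal_leI)
    next
      case top
      then show ?thesis
        using elim(1) by (simp add: ennreal_powr_def)
    qed
  qed
  then show thesis
    using that[of "C + 1"] C(2) by simp
qed

text \<open>The first two terms cover \<open>x\<close> up to the cutoff \<open>K\<close>, and the
  last covers \<open>x\<close> above it. After integration the coefficient \<open>K / K ^ n\<close>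
  meets a moment bound \<open>C ^ n\<close>, leaving \<open>K * (C / K) ^ n\<close>, which vanishes
  when \<open>C < K\<close>.\<close>

lemma le_truncation_plus_powr:
  fixes x c K \<gamma> :: real
  assumes "0 \<le> x" "0 \<le> c" "1 \<le> K" "1 \<le> \<gamma>" "1 \<le> n"
  shows "x \<le> c + K * indicator {c..} x + K / K ^ n * x powr (\<gamma> * real n)"
proof -
  have nonneg: "0 \<le> K / K ^ n * x powr (\<gamma> * real n)"
    using assms(3) by simp
  show ?thesis
  proof (cases "K < x")
    case False
    then have "x \<le> c + K * indicator {c..} x"
      using assms(2,3) by (simp add: indicator_def)
    then show ?thesis
      using nonneg by (rule add_increasing2[rotated])
  next
    case True
    \<comment> \<open>Since \<open>x\<close> exceeds \<open>K\<close>, which is at least 1, powers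
      of \<open>x\<close> grow with the exponent. Thus \<open>x * K powr (n - 1)\<close> is at most
      the \<open>n\<close>-th power of \<open>x\<close>, hence at most
      \<open>x powr (\<gamma> * n)\<close>.\<close>
    have "1 * real n \<le> \<gamma> * real n"
      using assms(4) by (intro mult_right_mono) auto
    then have "1 + (real n - 1) \<le> \<gamma> * real n"
      by simp
    then have "x powr (1 + (real n - 1)) \<le> x powr (\<gamma> * real n)"
      using True assms(3) by (intro powr_mono) auto
    then have "x * x powr (real n - 1) \<le> x powr (\<gamma> * real n)"
      using True assms(3) by (simp add: powr_mult_base flip: powr_add)
    moreover have "x * K powr (real n - 1) \<le> x * x powr (real n - 1)"
      using True assms(3,5) by (intro mult_left_mono powr_mono2) auto
    ultimately have "x * K powr (real n - 1) \<le> x powr (\<gamma> * real n)"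
      by (rule order_trans[rotated])
    moreover have "K powr (real n - 1) = K ^ n / K"
      using assms(3) by (simp add: powr_diff powr_realpow)
    ultimately have "x \<le> K / K ^ n * x powr (\<gamma> * real n)"
      using assms(3) by (simp add: field_simps)
    then show ?thesis
      using assms(2,3) by (simp add: indicator_def)
  qed
qed

text \<open>A Markov-type bound: the mean is at least \<open>c\<close> times the probability of
  exceeding \<open>c\<close>, and that probability tends to 1.\<close>

lemma limit_mean_ge:
  fixes c Rs :: real
  assumes "\<And>n. n \<ge> 1 \<Longrightarrow> prob_space (M n)"
    and "\<And>n. n \<ge> 1 \<Longrightarrow> X n \<in> borel_measurable (M n)"
    and "(\<lambda>n. \<integral>\<^sup>+ \<omega>. ennreal (X n \<omega>) \<partial>M n) \<longlonglongrightarrow> ennreal Rs"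
    and "0 \<le> Rs" "0 \<le> c"
    and "(\<lambda>n. measure (M n) {\<omega> \<in> space (M n). X n \<omega> \<in> {..c}}) \<longlonglongrightarrow> 0"
  shows "c \<le> Rs"
proof -
  define q where "q n = measure (M n) {\<omega> \<in> space (M n). X n \<omega> \<in> {..c}}" for n
  have "ennreal (c * (1 - q n)) \<le> (\<integral>\<^sup>+ \<omega>. ennreal (X n \<omega>) \<partial>M n)" if "1 \<le> n" for n
  proof -
    interpret prob_space "M n"
      using assms(1) that .
    note [measurable] = assms(2)[OF that]
    have "ennreal (c * (1 - q n)) = ennreal c * emeasure (M n) {\<omega> \<in> space (M n). \<not> X n \<omega> \<in> {..c}}"
      unfolding q_def using assms(5)
      by (subst prob_neg[symmetric]) (auto simp: ennreal_mult emeasure_eq_measure)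
    also have "\<dots> = (\<integral>\<^sup>+ \<omega>. ennreal c * indicator {\<omega> \<in> space (M n). \<not> X n \<omega> \<in> {..c}} \<omega> \<partial>M n)"
      by (subst nn_integral_cmult_indicator) auto
    also have "\<dots> \<le> (\<integral>\<^sup>+ \<omega>. ennreal (X n \<omega>) \<partial>M n)"
      by (intro nn_integral_mono) (auto simp: indicator_def intro: ennreal_leI)
    finally show ?thesis .
  qed
  moreover have "(\<lambda>n. ennreal (c * (1 - q n))) \<longlonglongrightarrow> ennreal (c * (1 - 0))"
    unfolding q_def by (intro tendsto_intros assms(6))
  ultimately have "ennreal c \<le> ennreal Rs"
    using assms(3) by (intro LIMSEQ_le[of "\<lambda>n. ennreal (c * (1 - q n))"]) auto
  then show ?thesis
    using assms(4) by (simp add: ennreal_le_iff)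
qed

text \<open>Convergence to 0 of the probability of \<open>{c..}\<close> alone does not control the
  mean, as large values may still contribute. Integrating the truncation bound splits the excess
  over \<open>c\<close> into \<open>K * p n\<close>, handled by concentration, and a tail handled by
  the moments.\<close>

lemma limit_mean_le:
  fixes c Rs \<gamma> :: real
  assumes "\<And>n. n \<ge> 1 \<Longrightarrow> prob_space (M n)"
    and "\<And>n. n \<ge> 1 \<Longrightarrow> X n \<in> borel_measurable (M n)"
    and "\<And>n. n \<ge> 1 \<Longrightarrow> AE \<omega> in M n. 0 \<le> X n \<omega>"
    and "(\<lambda>n. \<integral>\<^sup>+ \<omega>. ennreal (X n \<omega>) \<partial>M n) \<longlonglongrightarrow> ennreal Rs"
    and "0 \<le> c" "1 \<le> \<gamma>"
    and "limsup (\<lambda>n. ennreal_powr (\<integral>\<^sup>+ \<omega>. ennreal (X n \<omega> powr (\<gamma> * real n)) \<partial>M n) (1 / real n)) < \<infinity>"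
    and "(\<lambda>n. measure (M n) {\<omega> \<in> space (M n). X n \<omega> \<in> {c..}}) \<longlonglongrightarrow> 0"
  shows "Rs \<le> c"
proof -
  define p where "p n = measure (M n) {\<omega> \<in> space (M n). X n \<omega> \<in> {c..}}" for n
  obtain C where C: "0 < C" and
    moments: "eventually (\<lambda>n. (\<integral>\<^sup>+ \<omega>. ennreal (X n \<omega> powr (\<gamma> * real n)) \<partial>M n) \<le> ennreal (C ^ n)) sequentially"
    using eventually_le_power_of_limsup_root[OF assms(7)] .
  \<comment> \<open>This cutoff is at least 1, as the truncation bound requires, and makes the ratio
    \<open>C / K\<close> less than 1.\<close>
  define K where "K = C + 1"
  have K: "1 \<le> K" "C < K"
    using C by (auto simp: K_def)
  have "eventually (\<lambda>n. (\<integral>\<^sup>+ \<omega>. ennreal (X n \<omega>) \<partial>M n) \<le> ennreal (c + K * p n + K * (C / K) ^ n)) sequentially"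
    using moments eventually_ge_at_top[of 1]
  proof eventually_elim
    case (elim n)
    interpret prob_space "M n"
      using assms(1) elim(2) .
    note [measurable] = assms(2)[OF elim(2)]
    define A where "A = {\<omega> \<in> space (M n). X n \<omega> \<in> {c..}}"
    have [measurable]: "A \<in> sets (M n)"
      unfolding A_def by measurable
    have "(\<integral>\<^sup>+ \<omega>. ennreal (X n \<omega>) \<partial>M n) \<le>
      (\<integral>\<^sup>+ \<omega>. ennreal c + ennreal K * indicator A \<omega>
        + ennreal (K / K ^ n) * ennreal (X n \<omega> powr (\<gamma> * real n)) \<partial>M n)"
    proof (rule nn_integral_mono_AE)
      show "AE \<omega> in M n. ennreal (X n \<omega>) \<le> ennreal c + ennreal K * indicator A \<omega>
        + ennreal (K / K ^ n) * ennreal (X n \<omega> powr (\<gamma> * real n))"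
        using assms(3)[OF elim(2)] AE_space
      proof eventually_elim
        case (elim \<omega>)
        have "ennreal (X n \<omega>) \<le> ennreal (c + K * indicator {c..} (X n \<omega>)
            + K / K ^ n * X n \<omega> powr (\<gamma> * real n))"
          using elim(1) assms(5,6) K(1) \<open>1 \<le> n\<close>
          by (intro ennreal_leI le_truncation_plus_powr) auto
        also have "\<dots> = ennreal c + ennreal K * indicator A \<omega>
            + ennreal (K / K ^ n) * ennreal (X n \<omega> powr (\<gamma> * real n))"
          using elim assms(5) K(1) by (simp add: A_def indicator_def flip: ennreal_mult)
        finally show ?case .
      qed
    qed
    also have "\<dots> = ennreal c + ennreal K * ennreal (p n)
        + ennreal (K / K ^ n) * (\<integral>\<^sup>+ \<omega>. ennreal (X n \<omega> powr (\<gamma> * real n)) \<partial>M n)"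
      by (simp add: nn_integral_add nn_integral_cmult prob_space emeasure_eq_measure p_def
          flip: A_def del: atLeast_iff)
    also have "\<dots> \<le> ennreal c + ennreal K * ennreal (p n) + ennreal (K / K ^ n) * ennreal (C ^ n)"
      using elim(1) by (intro add_left_mono mult_left_mono) auto
    also have "\<dots> = ennreal (c + K * p n + K * (C / K) ^ n)"
      using assms(5) K(1) C by (simp add: p_def power_divide flip: ennreal_mult ennreal_plus)
    finally show ?case .
  qed
  moreover have "(\<lambda>n. ennreal (c + K * p n + K * (C / K) ^ n)) \<longlonglongrightarrow> ennreal (c + K * 0 + K * 0)"
    unfolding p_def using C K by (intro tendsto_intros assms(8) LIMSEQ_realpow_zero) auto
  ultimately have "ennreal Rs \<le> ennreal (c + K * 0 + K * 0)"
    using assms(4) by (intro tendsto_le[OF sequentially_bot])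
  then show ?thesis
    using assms(5) by (simp add: ennreal_le_iff)
qed

section \<open>Vanishing of the rate function at the limit mean\<close>

lemma rate_at_limit_mean:
  fixes Rs \<gamma> :: real
  assumes "\<And>n. n \<ge> 1 \<Longrightarrow> prob_space (M n)"
    and "\<And>n. n \<ge> 1 \<Longrightarrow> X n \<in> borel_measurable (M n)"
    and "\<And>n. n \<ge> 1 \<Longrightarrow> AE \<omega> in M n. 0 \<le> X n \<omega>"
    and "(\<lambda>n. \<integral>\<^sup>+ \<omega>. ennreal (X n \<omega>) \<partial>M n) \<longlonglongrightarrow> ennreal Rs"
    and "0 < Rs"
    and "good_rate_function I"
    and "convex_ereal I"
    and "large_deviations_principle M X I"
    and "1 \<le> \<gamma>"
    and "limsup (\<lambda>n. ennreal_powr (\<integral>\<^sup>+ \<omega>. ennreal (X n \<omega> powr (\<gamma> * real n)) \<partial>M n) (1 / real n)) < \<infinity>"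
  shows "I Rs = 0"
proof (rule ccontr)
  assume ne: "I Rs \<noteq> 0"
  have nonneg: "0 \<le> I x" for x
    using assms(6) unfolding good_rate_function_def by blast
  have "closed {x. I x \<le> ereal 0}"
    using assms(6) unfolding good_rate_function_def by (blast intro: compact_imp_closed)
  moreover have "{x. I x \<le> ereal 0} = {x. I x = 0}"
    using nonneg by (auto simp: zero_ereal_def[symmetric] intro: antisym)
  ultimately have "open (- {x. I x = 0})"
    by (simp add: open_Compl)
  \<comment> \<open>The zero set is closed, so a point outside it has a positive distance from it.
    The margin \<open>e\<close> is what yields a strict contradiction with the limit of the
    means.\<close>
  then obtain e where e: "0 < e" "cball Rs e \<subseteq> - {x. I x = 0}"
    using ne unfolding open_contains_cball by auto
  obtain z where z: "I z = 0"
    using ldp_zero_exists[OF assms(1,6,8)] .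
  consider "z < Rs" | "Rs < z"
    using ne z by (metis linorder_neqE_linordered_idom)
  then show False
  proof cases
    case 1
    \<comment> \<open>The maximum with 0 provides the nonnegative level needed by
      \<open>limit_mean_le\<close>; positivity of \<open>Rs\<close> still gives
      \<open>c < Rs\<close>.\<close>
    define c where "c = max 0 (Rs - e)"
    have "I x \<noteq> 0" if "x \<in> {c..}" for x
    proof
      assume "I x = 0"
      \<comment> \<open>A zero at or beyond \<open>Rs\<close>, together with the zero
        \<open>z\<close> before it, would force \<open>I Rs = 0\<close> by convexity. Any zero in
        \<open>{c..}\<close> would therefore lie within \<open>e\<close> of \<open>Rs\<close>,
        inside the zero-free ball.\<close>
      then have "\<not> Rs \<le> x"
        using convex_ereal_zero_between[OF assms(7) nonneg z, of x Rs] 1 ne by auto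
      then have "x \<in> cball Rs e"
        using that by (auto simp: c_def dist_real_def)
      with e(2) \<open>I x = 0\<close> show False
        by auto
    qed
    then have "(\<lambda>n. measure (M n) {\<omega> \<in> space (M n). X n \<omega> \<in> {c..}}) \<longlonglongrightarrow> 0"
      by (intro ldp_measure_tendsto_zero[OF assms(6,8)]) auto
    then have "Rs \<le> c"
      by (intro limit_mean_le[OF assms(1-4) _ assms(9,10)]) (auto simp: c_def)
    then show False
      using e(1) assms(5) by (simp add: c_def)
  next
    case 2
    define c where "c = Rs + e"
    have "I x \<noteq> 0" if "x \<in> {..c}" for x
    proof
      assume "I x = 0"
      then have "\<not> x \<le> Rs"
        using convex_ereal_zero_between[OF assms(7) nonneg _ z, of x Rs] 2 ne by auto
      then have "x \<in> cball Rs e"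
        using that by (auto simp: c_def dist_real_def)
      with e(2) \<open>I x = 0\<close> show False
        by auto
    qed
    then have "(\<lambda>n. measure (M n) {\<omega> \<in> space (M n). X n \<omega> \<in> {..c}}) \<longlonglongrightarrow> 0"
      by (intro ldp_measure_tendsto_zero[OF assms(6,8)]) auto
    then have "c \<le> Rs"
      by (rule limit_mean_ge[OF assms(1,2,4), rotated -1]) (use assms(5) e(1) in \<open>auto simp: c_def\<close>)
    then show False
      using e(1) by (simp add: c_def)
  qed
qed

section \<open>Comparison of the thresholds\<close>

lemma percolation_le_volume_fraction:
  assumes "0 < Rs"
  shows "percolation_threshold I Rs \<le> volume_fraction_threshold I Rs"
  unfolding percolation_threshold_def volume_fraction_threshold_def
proof (intro add_left_mono INF_mono)
  fix R assume R: "R \<in> {Rs..}"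
  then have "I R - ereal (ln (R + Rs)) \<le> I R - ereal (ln R)"
    using assms by (intro ereal_minus_mono) auto
  then show "\<exists>R'\<in>{Rs..}. I R' - ereal (ln (R' + Rs)) \<le> I R - ereal (ln R)"
    using R by blast
qed

lemma degree_le_percolation:
  assumes "convex_ereal I" "\<And>x. 0 \<le> I x" "I Rs = 0"
  shows "degree_threshold I Rs \<le> percolation_threshold I Rs"
  unfolding degree_threshold_def percolation_threshold_def
proof (intro add_left_mono INF_greatest)
  fix R assume R: "R \<in> {Rs..}"
  have "I (1/2 * R + (1 - 1/2) * Rs) \<le> ereal (1/2) * I R + ereal (1 - 1/2) * I Rs"
    using assms(1)[unfolded convex_ereal_def, rule_format, of "1/2" R Rs] by simp
  moreover have "1/2 * R + (1 - 1/2) * Rs = (R + Rs) / 2"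
    by simp
  ultimately have "I ((R + Rs) / 2) \<le> ereal (1/2) * I R"
    using assms(3) by (simp only: ereal_zero_mult add_0_right ereal_mult_zero)
  \<comment> \<open>The case split treats infinite values of \<open>I\<close>: the claim is trivial
    if \<open>I R\<close> is infinite, and a finite \<open>I R\<close> forces a finite value at the
    midpoint.\<close>
  then have "2 * I ((R + Rs) / 2) \<le> I R"
    using assms(2)[of "(R + Rs) / 2"] assms(2)[of R]
    by (cases "I R"; cases "I ((R + Rs) / 2)") auto
  \<comment> \<open>At the midpoint the two logarithmic terms coincide, so only the rate terms
    remain to be compared.\<close>
  moreover have "2 * ((R + Rs) / 2) = R + Rs"
    by simp
  ultimately have "2 * I ((R + Rs) / 2) - ereal (ln (2 * ((R + Rs) / 2))) \<le> I R - ereal (ln (R + Rs))"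
    by (simp only: ereal_minus_mono order_refl)
  moreover have "(R + Rs) / 2 \<in> {Rs..}"
    using R by simp
  ultimately show "(INF R\<in>{Rs..}. 2 * I R - ereal (ln (2 * R))) \<le> I R - ereal (ln (R + Rs))"
    by (rule INF_lower2[rotated])
qed

theorem theorem5:
  fixes M :: "nat \<Rightarrow> 'a measure"
    and X :: "nat \<Rightarrow> 'a \<Rightarrow> real"
    and I :: "real \<Rightarrow> ereal"
    and Rs \<gamma> :: real
  assumes "\<And>n. n \<ge> 1 \<Longrightarrow> prob_space (M n)"
    and "\<And>n. n \<ge> 1 \<Longrightarrow> X n \<in> borel_measurable (M n)"
    and "\<And>n. n \<ge> 1 \<Longrightarrow> AE \<omega> in M n. 0 \<le> X n \<omega>"
    and "(\<lambda>n. \<integral>\<^sup>+ \<omega>. ennreal (X n \<omega>) \<partial>M n) \<longlonglongrightarrow> ennreal Rs"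
    and "0 < Rs"
    and "good_rate_function I"
    and "convex_ereal I"
    and "large_deviations_principle M X I"
    and "1 < \<gamma>"
    and "limsup (\<lambda>n. ennreal_powr (\<integral>\<^sup>+ \<omega>. ennreal (X n \<omega> powr (\<gamma> * real n)) \<partial>M n) (1 / real n)) < \<infinity>"
  shows "degree_threshold I Rs \<le> percolation_threshold I Rs
    \<and> percolation_threshold I Rs \<le> volume_fraction_threshold I Rs"
proof
  have "I Rs = 0"
    using rate_at_limit_mean[OF assms(1-8) _ assms(10)] assms(9) by simp
  then show "degree_threshold I Rs \<le> percolation_threshold I Rs"
    using assms(6,7) by (intro degree_le_percolation) (auto simp: good_rate_function_def)
  show "percolation_threshold I Rs \<le> volume_fraction_threshold I Rs"
    using assms(5) by (rule percolation_le_volume_fraction)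
qed

end
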